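(* There is a universal constant $C_1>0$ such that the following holds. Let $p,q$ be relatively prime positive integers with $p<q$, and let $R$ be a $p\times q$ rectangle. Then: (i) every tiling of $R$ by finitely many squares (of arbitrary positive real side lengths) uses at least $\max\{q/p,\ \log_2 q\}$ squares; (ii) there exists a tiling of $R$ by squares of positive integer side lengths using at most $q/p+C_1\log_2 p$ squares.
   Context: A tiling of a rectangle by squares is a finite collection of closed squares (sides parallel to those of the rectangle) with pairwise disjoint interiors whose union is the rectangle. *)

theory Defs
  imports "HOL-Analysis.Analysis"
begin

definition is_rectangle :: "real \<Rightarrow> real \<Rightarrow> (real \<times> real) set \<Rightarrow> bool" where
  "is_rectangle w h R \<longleftrightarrow> (\<exists>x y. R = {x..x + w} \<times> {y..y + h})"

definition is_square :: "real \<Rightarrow> (real \<times> real) set \<Rightarrow> bool" where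
  "is_square s S \<longleftrightarrow> s > 0 \<and> is_rectangle s s S"

text \<open>A tiling is a set of tiles, so the number of squares is its cardinality; tiles
  with disjoint (nonempty) interiors are never equal as point sets, so nothing is lost by
  using a set rather than an indexed family.\<close>

definition square_tiling :: "(real \<times> real) set set \<Rightarrow> (real \<times> real) set \<Rightarrow> bool" where
  "square_tiling T R \<longleftrightarrow>
     finite T \<and>
     (\<forall>S\<in>T. \<exists>s. is_square s S) \<and>
     pairwise (\<lambda>S S'. interior S \<inter> interior S' = {}) T \<and>
     \<Union>T = R"

definition integer_sided :: "(real \<times> real) set set \<Rightarrow> bool" where
  "integer_sided T \<longleftrightarrow> (\<forall>S\<in>T. \<exists>n::nat. n > 0 \<and> is_square (real n) S)"

end

theory Submission
  imports Defs "HOL-Number_Theory.Cong"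
begin

text \<open>
  Lower bound. Read a tiling as an electrical network whose nodes are the heights at which tiles
  begin or end and whose edges are the tiles, with a tile's side as both voltage and current:
  horizontal slices give Kirchhoff's law. Let \<open>D\<close> be the number of spanning forests rooted at
  the top and bottom heights, and \<open>N v\<close> the number of those in which \<open>v\<close> belongs to the top
  root. Then \<open>N\<close> is an integer-valued function, harmonic at the inner heights, and Green's
  identity for \<open>N\<close> and the height yields \<open>q * K = p * D\<close> with an integer \<open>K\<close>. Hence \<open>q\<close>
  divides \<open>D\<close>, and \<open>D \<le> 2 ^ card T\<close> because a rooted forest is determined by its edge set.

  Upper bound. Euclid's algorithm is cheap except on rectangles \<open>n \<times> (n + d)\<close> with \<open>d\<close> much
  smaller than \<open>n\<close>. If \<open>n\<close> or \<open>n + d\<close> is even, three squares of side about \<open>n / 2\<close> reduce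
  \<open>(n, d)\<close> to about \<open>(n / 2, 2 * d)\<close>. If both are odd and \<open>2 ^ k\<close> exactly divides \<open>d\<close>, the
  three squares leave in addition a small rectangle in the middle, a multiple of
  \<open>b \<times> (2 ^ k - b)\<close>, where \<open>b\<close> can be chosen such that a power of two of about the size
  of the small rectangle cancels from the remaining large one. The potential
  \<open>400 * log 2 n + 6 * log 2 d\<close> decreases sufficiently in every step.
\<close>

subsection \<open>Rooted forests and harmonic functions\<close>

text \<open>Edges are abstract objects, so several tiles between the same two heights stay distinct.
  The nodes outside \<open>I\<close> are the roots. \<open>descent\<close> gives every inner node a
  downward edge, which makes a forest exist.\<close>

locale level_network =
  fixes E :: "'e set" and hi lo :: "'e \<Rightarrow> 'v::linorder" and I :: "'v set"
  assumes finite_E: "finite E" and finite_I: "finite I"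
    and lo_less_hi: "e \<in> E \<Longrightarrow> lo e < hi e"
    and descent: "u \<in> I \<Longrightarrow> \<exists>e\<in>E. hi e = u"
begin

definition other :: "'v \<Rightarrow> 'e \<Rightarrow> 'v" where
  "other u e = (if hi e = u then lo e else hi e)"

definition inc :: "'v \<Rightarrow> 'e set" where
  "inc u = {e \<in> E. hi e = u \<or> lo e = u}"

definition succ :: "('v \<Rightarrow> 'e) \<Rightarrow> 'v \<Rightarrow> 'v" where
  "succ F u = (if u \<in> I then other u (F u) else u)"

definition reach :: "('v \<Rightarrow> 'e) \<Rightarrow> 'v \<Rightarrow> 'v \<Rightarrow> bool" where
  "reach F u w \<longleftrightarrow> (\<exists>k. (succ F ^^ k) u = w)"

text \<open>A rooted forest is encoded by the first edge on the way from each inner node to its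
  root. The second condition excludes cycles; \<open>PiE\<close> fixes the values off
  \<open>I\<close>, so that a forest is a single function.\<close>

definition forests :: "('v \<Rightarrow> 'e) set" where
  "forests = {F \<in> PiE I inc. \<forall>u. \<exists>w. w \<notin> I \<and> reach F u w}"

definition linked :: "'v \<Rightarrow> 'v \<Rightarrow> nat" where
  "linked t u = card {F \<in> forests. reach F u t}"

lemma reach_refl [simp]: "reach F u u"
  unfolding reach_def by (rule exI[of _ 0]) simp

lemma reach_trans: "reach F u v \<Longrightarrow> reach F v w \<Longrightarrow> reach F u w"
  unfolding reach_def by (metis comp_apply funpow_add)

lemma reach_succ: "reach F (succ F u) w \<Longrightarrow> reach F u w"
  unfolding reach_def by (metis funpow_Suc_right comp_apply)

lemma reach_step: "reach F u w \<longleftrightarrow> u = w \<or> reach F (succ F u) w"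
proof
  assume "reach F u w"
  then obtain k where k: "(succ F ^^ k) u = w" unfolding reach_def by blast
  show "u = w \<or> reach F (succ F u) w"
  proof (cases k)
    case 0
    with k show ?thesis by simp
  next
    case (Suc j)
    with k show ?thesis unfolding reach_def by (auto simp: funpow_swap1)
  qed
qed (auto intro: reach_succ)

lemma funpow_outside: "u \<notin> I \<Longrightarrow> (succ F ^^ k) u = u"
  by (induction k) (simp_all add: succ_def)

lemma reach_outside: "u \<notin> I \<Longrightarrow> reach F u w \<longleftrightarrow> w = u"
  unfolding reach_def using funpow_outside by auto

lemma reach_linear: "reach F u v \<Longrightarrow> reach F u w \<Longrightarrow> reach F v w \<or> reach F w v"
proof -
  assume "reach F u v" "reach F u w"
  then obtain i j where ij: "(succ F ^^ i) u = v" "(succ F ^^ j) u = w"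
    unfolding reach_def by blast
  show ?thesis
  proof (cases "i \<le> j")
    case True
    then have "(succ F ^^ (j - i)) v = w"
      using ij by (metis comp_apply funpow_add le_add_diff_inverse2)
    then show ?thesis unfolding reach_def by blast
  next
    case False
    then have "(succ F ^^ (i - j)) w = v"
      using ij by (metis comp_apply funpow_add le_add_diff_inverse2 nat_le_linear)
    then show ?thesis unfolding reach_def by blast
  qed
qed

lemma reach_exit: "reach F u v \<Longrightarrow> t \<notin> I \<Longrightarrow> reach F u t \<longleftrightarrow> reach F v t"
  using reach_linear[of F u v t] reach_trans[of F u v t] reach_outside[of t F v] by auto

lemma forest_leaves: "F \<in> forests \<Longrightarrow> \<exists>w. w \<notin> I \<and> reach F u w"
  unfolding forests_def by blast

lemma forest_inc: "F \<in> forests \<Longrightarrow> u \<in> I \<Longrightarrow> F u \<in> inc u"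
  unfolding forests_def by blast

lemma finite_inc [simp]: "finite (inc u)"
  using finite_E unfolding inc_def by simp

lemma finite_forests [simp]: "finite forests"
proof -
  have "finite (PiE I inc)" using finite_I by (intro finite_PiE) auto
  then show ?thesis unfolding forests_def by simp
qed

section \<open>Acyclicity and the number of forests\<close>

lemma closed_not_forest:
  assumes "u \<in> C" "C \<subseteq> I" "\<And>v. v \<in> C \<Longrightarrow> succ F v \<in> C"
  shows "F \<notin> forests"
proof
  assume "F \<in> forests"
  then obtain w where w: "w \<notin> I" "reach F u w" using forest_leaves by blast
  have "(succ F ^^ k) u \<in> C" for k by (induction k) (use assms in auto)
  with w assms show False unfolding reach_def by blast
qed

text \<open>Otherwise the nodes that reach \<open>u\<close> and are reached from it form a set of
  inner nodes closed under \<open>succ F\<close>, which no path to a root can leave.\<close>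

lemma forest_no_return:
  assumes "F \<in> forests" "u \<in> I"
  shows "\<not> reach F (succ F u) u"
proof
  assume r: "reach F (succ F u) u"
  let ?C = "{v. reach F u v \<and> reach F v u}"
  have 1: "u \<in> ?C" by simp
  have 2: "?C \<subseteq> I" using assms(2) reach_outside[of _ F u] by auto
  have 3: "succ F v \<in> ?C" if "v \<in> ?C" for v
  proof -
    have "reach F u (succ F v)"
      using that reach_trans[of F u v "succ F v"] reach_succ[of F v "succ F v"] by simp
    moreover have "reach F (succ F v) u"
      using that r reach_step[of F v u] by blast
    ultimately show ?thesis by blast
  qed
  from closed_not_forest[OF 1 2 3] assms(1) show False by blast
qed

lemma inc_both: "e \<in> inc u \<Longrightarrow> e \<in> inc v \<Longrightarrow> v \<noteq> u \<Longrightarrow> v = other u e"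
  unfolding inc_def other_def by auto

text \<open>If \<open>F\<close> and \<open>G\<close> differ at \<open>u\<close>, then
  \<open>G\<close> uses the edge \<open>F u\<close> at its other end \<open>z\<close>. They also
  differ at \<open>z\<close>, as \<open>F\<close> would otherwise run back along the same edge. So
  the set of differences is closed under \<open>succ F\<close>, and a forest admits no such nonempty
  set.\<close>

lemma inj_on_forest_edges: "inj_on (\<lambda>F. F ` I) forests"
proof (rule inj_onI)
  fix F G assume F: "F \<in> forests" and G: "G \<in> forests" and eq: "F ` I = G ` I"
  let ?C = "{u \<in> I. F u \<noteq> G u}"
  have step: "succ F u \<in> ?C" if "u \<in> ?C" for u
  proof -
    from that have u: "u \<in> I" "F u \<noteq> G u" by auto
    then obtain z where z: "z \<in> I" "F u = G z" using eq by (metis imageE imageI)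
    have zu: "z \<noteq> u" using z u by auto
    have "F u \<in> inc u" "F u \<in> inc z"
      using forest_inc[OF F u(1)] forest_inc[OF G z(1)] z(2) by simp_all
    then have zo: "z = other u (F u)" and uz: "u = other z (F u)"
      using inc_both zu by auto
    have sz: "succ F u = z" using u zo by (simp add: succ_def)
    have "F z \<noteq> G z"
    proof
      assume "F z = G z"
      then have "succ F z = u" using z uz by (simp add: succ_def)
      then have "reach F (succ F u) u"
        using sz reach_succ[of F z u] by simp
      with forest_no_return F u show False by blast
    qed
    with sz z show ?thesis by simp
  qed
  have "?C = {}"
  proof (rule ccontr)
    assume "?C \<noteq> {}"
    then obtain u where "u \<in> ?C" by blast
    from closed_not_forest[OF this _ step] F show False by blast
  qed
  moreover have "F \<in> extensional I" "G \<in> extensional I"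
    using F G unfolding forests_def by (auto simp: PiE_def)
  ultimately show "F = G" by (auto intro: extensionalityI)
qed

lemma card_forests_le: "card forests \<le> 2 ^ card E"
proof -
  have "card forests = card ((\<lambda>F. F ` I) ` forests)"
    using card_image[OF inj_on_forest_edges] by simp
  also have "\<dots> \<le> card (Pow E)"
    using finite_E forest_inc by (intro card_mono) (auto simp: inc_def)
  finally show ?thesis using finite_E by (simp add: card_Pow)
qed

text \<open>Choosing a downward edge at every inner node makes each path strictly decreasing, so it
  cannot stay in the finite set \<open>I\<close>.\<close>

lemma forests_nonempty: "forests \<noteq> {}"
proof -
  define F where "F = restrict (\<lambda>u. SOME e. e \<in> E \<and> hi e = u) I"
  have F: "F u \<in> E \<and> hi (F u) = u" if "u \<in> I" for u
    using someI_ex[of "\<lambda>e. e \<in> E \<and> hi e = u"] descent[OF that] that unfolding F_def by auto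
  have less: "succ F u < u" if "u \<in> I" for u
    using F[OF that] lo_less_hi[of "F u"] that by (simp add: succ_def other_def)
  have "\<exists>w. w \<notin> I \<and> reach F u w" for u
  proof (rule ccontr)
    assume "\<not> ?thesis"
    then have inI: "w \<in> I" if "reach F u w" for w using that by blast
    define W where "W = {w. reach F u w}"
    have "finite W" using inI finite_I unfolding W_def by (auto intro: finite_subset)
    moreover have "W \<noteq> {}" unfolding W_def using reach_refl by blast
    ultimately obtain m where m: "m \<in> W" "\<And>w. w \<in> W \<Longrightarrow> m \<le> w"
      using Min_in Min_le by metis
    have "reach F u (succ F m)"
      using m(1) reach_trans[of F u m] reach_succ[of F m "succ F m"] by (simp add: W_def)
    then have "m \<le> succ F m" using m(2) by (simp add: W_def)
    moreover have "succ F m < m" using less inI m(1) by (simp add: W_def)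
    ultimately show False by simp
  qed
  moreover have "F \<in> PiE I inc"
    using F by (auto simp: F_def inc_def)
  ultimately show ?thesis unfolding forests_def by blast
qed

section \<open>Forest counts as a harmonic function\<close>

lemma linked_self: "linked t t = card forests"
  unfolding linked_def by simp

lemma linked_outside: "b \<notin> I \<Longrightarrow> b \<noteq> t \<Longrightarrow> linked t b = 0"
  unfolding linked_def by (simp add: reach_outside)

lemma reach_fun_upd_avoid:
  assumes "\<not> reach F z u"
  shows "reach (F(u := e)) z w \<longleftrightarrow> reach F z w"
proof -
  have "(succ (F(u := e)) ^^ k) z = (succ F ^^ k) z" for k
  proof (induction k)
    case (Suc k)
    have "(succ F ^^ k) z \<noteq> u" using assms unfolding reach_def by blast
    then have "succ (F(u := e)) ((succ F ^^ k) z) = succ F ((succ F ^^ k) z)"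
      by (simp add: succ_def)
    with Suc show ?case by (simp del: fun_upd_apply)
  qed simp
  then show ?thesis unfolding reach_def by simp
qed

lemma reach_fun_upd_to: "reach F z u \<Longrightarrow> reach (F(u := e)) z u"
proof -
  assume "reach F z u"
  then obtain k where "(succ F ^^ k) z = u" unfolding reach_def by blast
  then show ?thesis
  proof (induction k arbitrary: z)
    case (Suc k)
    show ?case
    proof (cases "z = u")
      case False
      then have "succ (F(u := e)) z = succ F z" by (simp add: succ_def)
      moreover have "(succ F ^^ k) (succ F z) = u"
        using Suc.prems by (simp add: funpow_swap1)
      ultimately show ?thesis using Suc.IH[of "succ F z"] reach_succ by metis
    qed simp
  qed simp
qed

text \<open>The old path from the far end of \<open>e\<close> avoids \<open>u\<close>, so it
  survives the change and takes \<open>u\<close>, and every node that led to \<open>u\<close>, to a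
  root.\<close>

lemma forest_fun_upd:
  assumes F: "F \<in> forests" and u: "u \<in> I" and e: "e \<in> inc u"
    and avoid: "\<not> reach F (other u e) u"
  shows "F(u := e) \<in> forests"
proof -
  let ?G = "F(u := e)"
  have "?G \<in> PiE I inc" using F u e unfolding forests_def by (auto simp: PiE_def Pi_def extensional_def)
  moreover have "\<exists>w. w \<notin> I \<and> reach ?G z w" for z
  proof (cases "reach F z u")
    case False
    then show ?thesis using forest_leaves[OF F] reach_fun_upd_avoid by simp
  next
    case True
    obtain w where w: "w \<notin> I" "reach F (other u e) w" using forest_leaves[OF F] by blast
    then have "reach ?G (other u e) w" using reach_fun_upd_avoid[OF avoid] by simp
    moreover have "succ ?G u = other u e" using u by (simp add: succ_def)
    ultimately have "reach ?G u w" using reach_succ by metis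
    then show ?thesis using w reach_trans reach_fun_upd_to[OF True] by blast
  qed
  ultimately show ?thesis unfolding forests_def by blast
qed

text \<open>Rerouting \<open>u\<close> along \<open>e\<close> and releasing the old edge at \<open>u\<close> is an involution on the
  pairs (edge at \<open>u\<close>, forest). It exchanges the pairs in which \<open>u\<close> leads to \<open>t\<close> with those in
  which the far end of the edge does.\<close>

lemma linked_harmonic:
  assumes u: "u \<in> I" and t: "t \<notin> I"
  shows "(\<Sum>e\<in>inc u. linked t u) = (\<Sum>e\<in>inc u. linked t (other u e))"
proof -
  let ?P = "SIGMA e:inc u. {F \<in> forests. reach F u t}"
  let ?Q = "SIGMA e:inc u. {F \<in> forests. reach F (other u e) t}"
  \<comment> \<open>If the far end of \<open>e\<close> already leads to \<open>u\<close>, rerouting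
    would close a cycle. Such pairs stay fixed; there \<open>u\<close> and the far end have the same
    root.\<close>
  define swap where
    "swap = (\<lambda>(e, F). if reach F (other u e) u then (e, F) else (F u, F(u := e)))"
  have far: "other u (F u) = succ F u" for F using u by (simp add: succ_def)
  have key: "swap x \<in> (SIGMA e:inc u. forests)" "swap (swap x) = x"
    "x \<in> ?P \<Longrightarrow> swap x \<in> ?Q" "x \<in> ?Q \<Longrightarrow> swap x \<in> ?P"
    if "x \<in> (SIGMA e:inc u. forests)" for x
  proof -
    obtain e F where x: "x = (e, F)" by (cases x)
    with that have e: "e \<in> inc u" and F: "F \<in> forests" by auto
    have "swap x \<in> (SIGMA e:inc u. forests) \<and> swap (swap x) = x \<and>
      (x \<in> ?P \<longrightarrow> swap x \<in> ?Q) \<and> (x \<in> ?Q \<longrightarrow> swap x \<in> ?P)"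
    proof (cases "reach F (other u e) u")
      case True
      then have "reach F (other u e) t \<longleftrightarrow> reach F u t" using reach_exit t by blast
      with True show ?thesis using x e F by (auto simp: swap_def)
    next
      case False
      let ?G = "F(u := e)"
      have G: "?G \<in> forests" using forest_fun_upd[OF F u e False] .
      have av: "\<not> reach F (succ F u) u" using forest_no_return[OF F u] .
      then have av': "\<not> reach ?G (other u (F u)) u"
        using reach_fun_upd_avoid far by simp
      have sw: "swap x = (F u, ?G)" using False x by (simp add: swap_def)
      have "swap (swap x) = x" unfolding sw using av' x by (simp add: swap_def)
      moreover have "reach ?G (other u (F u)) t" if "reach F u t"
        using that reach_step[of F u t] u t reach_fun_upd_avoid[OF av] far by auto
      moreover have "reach ?G u t" if "reach F (other u e) t"
      proof -
        have "succ ?G u = other u e" using u by (simp add: succ_def)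
        then show ?thesis using that reach_fun_upd_avoid[OF False] reach_succ by metis
      qed
      ultimately show ?thesis using sw G forest_inc[OF F u] x by auto
    qed
    then show "swap x \<in> (SIGMA e:inc u. forests)" "swap (swap x) = x"
      "x \<in> ?P \<Longrightarrow> swap x \<in> ?Q" "x \<in> ?Q \<Longrightarrow> swap x \<in> ?P" by auto
  qed
  have "bij_betw swap ?P ?Q"
  proof (rule bij_betw_byWitness[where f' = swap])
    have P: "?P \<subseteq> (SIGMA e:inc u. forests)" and Q: "?Q \<subseteq> (SIGMA e:inc u. forests)" by auto
    show "\<forall>x\<in>?P. swap (swap x) = x" "\<forall>x\<in>?Q. swap (swap x) = x"
      using key(2) P Q by blast+
    show "swap ` ?P \<subseteq> ?Q" using key(3) P by blast
    show "swap ` ?Q \<subseteq> ?P" using key(4) Q by blast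
  qed
  then have "card ?P = card ?Q" by (rule bij_betw_same_card)
  then show ?thesis unfolding linked_def by (subst (asm) (1 2) card_SigmaI) auto
qed

end

section \<open>Green's identity on a network\<close>

text \<open>Discrete summation by parts: the edges are grouped once by their upper and once by their
  lower ends.\<close>

lemma sum_edges_by_level:
  fixes s :: "'e \<Rightarrow> real"
  assumes "finite E" "finite V" "hi ` E \<union> lo ` E \<subseteq> V"
  shows "(\<Sum>e\<in>E. s e * (N (hi e) - N (lo e))) =
    (\<Sum>v\<in>V. N v * ((\<Sum>e | e \<in> E \<and> hi e = v. s e) - (\<Sum>e | e \<in> E \<and> lo e = v. s e)))"
proof -
  have "(\<Sum>v\<in>V. N v * (\<Sum>e | e \<in> E \<and> f e = v. s e)) = (\<Sum>e\<in>E. s e * N (f e))"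
    if "f ` E \<subseteq> V" for f
  proof -
    have "(\<Sum>v\<in>V. N v * (\<Sum>e | e \<in> E \<and> f e = v. s e)) =
        (\<Sum>v\<in>V. \<Sum>e | e \<in> E \<and> f e = v. s e * N (f e))"
      by (intro sum.cong refl) (simp add: sum_distrib_left mult.commute)
    also have "\<dots> = (\<Sum>e\<in>E. s e * N (f e))"
      using assms that by (intro sum.group) auto
    finally show ?thesis .
  qed
  from this[of hi] this[of lo] assms show ?thesis
    by (simp add: right_diff_distrib sum_subtractf)
qed

text \<open>The heights satisfy Kirchhoff's law with flow \<open>p\<close>, and the forest counts are integers
  which are harmonic off \<open>t\<close> and \<open>b\<close>; Green's identity for this pair of functions
  gives the equation.\<close>

lemma (in level_network) forest_green:
  fixes p :: real and h :: "'v \<Rightarrow> real"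
  assumes t: "t \<notin> I" and b: "b \<notin> I" and tb: "t \<noteq> b"
    and ends: "hi ` E \<union> lo ` E \<subseteq> insert t (insert b I)"
    and flow: "\<And>v. v \<in> insert t (insert b I) \<Longrightarrow>
      (\<Sum>e | e \<in> E \<and> hi e = v. h (hi e) - h (lo e)) - (\<Sum>e | e \<in> E \<and> lo e = v. h (hi e) - h (lo e))
        = (if v = t then p else if v = b then - p else 0)"
  shows "\<exists>K::int. (h t - h b) * K = p * card forests"
proof -
  let ?V = "insert t (insert b I)"
  have fin: "finite ?V" using finite_I by simp
  let ?N = "\<lambda>v. real (linked t v)"
  define d where "d e = ?N (hi e) - ?N (lo e)" for e
  \<comment> \<open>\<open>L\<close> is the graph Laplacian of the forest counts; its sum over
    incident edges in \<open>L_inc\<close> is what \<open>linked_harmonic\<close> evaluates.\<close>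
  define L where "L v = (\<Sum>e | e \<in> E \<and> hi e = v. d e) - (\<Sum>e | e \<in> E \<and> lo e = v. d e)" for v
  have L_inc: "L v = (\<Sum>e\<in>inc v. ?N v - ?N (other v e))" for v
  proof -
    have "(\<Sum>e\<in>inc v. ?N v - ?N (other v e)) =
      (\<Sum>e | e \<in> E \<and> hi e = v. ?N v - ?N (other v e)) + (\<Sum>e | e \<in> E \<and> lo e = v. ?N v - ?N (other v e))"
    proof (subst sum.union_disjoint[symmetric])
      show "{e \<in> E. hi e = v} \<inter> {e \<in> E. lo e = v} = {}" using lo_less_hi by fastforce
    qed (use finite_E in \<open>auto simp: inc_def intro!: sum.cong\<close>)
    also have "\<dots> = (\<Sum>e | e \<in> E \<and> hi e = v. d e) + (\<Sum>e | e \<in> E \<and> lo e = v. - d e)"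
    proof (intro arg_cong2[where f = "(+)"] sum.cong refl)
      fix e assume "e \<in> {e \<in> E. lo e = v}"
      then show "?N v - ?N (other v e) = - d e"
        using lo_less_hi[of e] by (auto simp: other_def d_def)
    qed (auto simp: other_def d_def)
    finally show ?thesis by (simp add: L_def sum_negf)
  qed
  have L_0: "L v = 0" if "v \<in> I" for v
  proof -
    have "(\<Sum>e\<in>inc v. ?N v) = (\<Sum>e\<in>inc v. ?N (other v e))"
      using arg_cong[OF linked_harmonic[OF that t], of real] by (simp del: sum_constant)
    then show ?thesis unfolding L_inc by (simp add: sum_subtractf del: sum_constant)
  qed
  have V_split: "(\<Sum>v\<in>?V. f v) = f t + f b + (\<Sum>v\<in>I. f v)" for f :: "'v \<Rightarrow> real"
    using finite_I t b tb by simp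
  have ends': "hi ` E \<union> lo ` E \<subseteq> ?V" using ends .
  \<comment> \<open>Heights are measured from \<open>b\<close>, so that the term of \<open>b\<close>
    vanishes and only \<open>t\<close> contributes.\<close>
  have "(\<Sum>e\<in>E. d e * ((h (hi e) - h b) - (h (lo e) - h b))) = (\<Sum>v\<in>?V. (h v - h b) * L v)"
    unfolding L_def by (rule sum_edges_by_level[OF finite_E fin ends', where N = "\<lambda>v. h v - h b"])
  also have "\<dots> = (h t - h b) * L t" unfolding V_split by (simp add: L_0)
  finally have 1: "(\<Sum>e\<in>E. d e * (h (hi e) - h (lo e))) = (h t - h b) * L t" by simp
  \<comment> \<open>The same sum with the roles exchanged: now the flow of the heights vanishes at
    the inner nodes, all forests link \<open>t\<close> to itself, and none links \<open>b\<close> to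
    \<open>t\<close>.\<close>
  have "(\<Sum>e\<in>E. (h (hi e) - h (lo e)) * (?N (hi e) - ?N (lo e))) =
      (\<Sum>v\<in>?V. ?N v * (if v = t then p else if v = b then - p else 0))"
    using sum_edges_by_level[OF finite_E fin ends', where N = ?N and s = "\<lambda>e. h (hi e) - h (lo e)"]
    by (simp only: flow cong: sum.cong)
  also have "\<dots> = p * card forests"
  proof -
    have "(\<Sum>v\<in>I. ?N v * (if v = t then p else if v = b then - p else 0)) = 0"
      using t b by (intro sum.neutral) auto
    then show ?thesis unfolding V_split
      using tb linked_self[of t] linked_outside[OF b tb[symmetric]] by simp
  qed
  finally have 2: "(h t - h b) * L t = p * card forests"
    using 1 by (simp add: d_def mult.commute)
  have "L t = of_int (\<Sum>e\<in>inc t. int (linked t t) - int (linked t (other t e)))"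
    unfolding L_inc by simp
  with 2 show ?thesis by metis
qed

subsection \<open>Horizontal slices of a tiling\<close>

lemma negligible_Int_adjacent_intervals:
  fixes a b c d :: real
  assumes "{a<..<b} \<inter> {c<..<d} = {}"
  shows "negligible ({a..b} \<inter> {c..d})"
proof -
  have "{a..b} \<inter> {c..d} \<subseteq> {a,b,c,d}"
  proof
    fix x assume x: "x \<in> {a..b} \<inter> {c..d}"
    show "x \<in> {a,b,c,d}"
    proof (rule ccontr)
      assume "x \<notin> {a,b,c,d}"
      with x have "x \<in> {a<..<b} \<inter> {c<..<d}" by auto
      with assms show False by blast
    qed
  qed
  then show ?thesis by (meson finite.emptyI finite.insertI finite_subset negligible_finite)
qed

lemma interior_rectangle:
  "interior ({a..b} \<times> {c..d}) = {a<..<b::real} \<times> {c<..<d::real}"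
  by (simp add: interior_Times interior_atLeastAtMost_real)

locale tiled_rectangle =
  fixes T :: "(real \<times> real) set set" and X Y w h :: real
    and left bot side :: "(real \<times> real) set \<Rightarrow> real"
  assumes tiling: "square_tiling T ({X..X + w} \<times> {Y..Y + h})"
    and w_pos: "0 < w" and h_pos: "0 < h"
    and side_pos: "S \<in> T \<Longrightarrow> 0 < side S"
    and tile_eq: "S \<in> T \<Longrightarrow> S = {left S..left S + side S} \<times> {bot S..bot S + side S}"
begin

definition top :: "(real \<times> real) set \<Rightarrow> real" where
  "top S = bot S + side S"

lemma finite_T: "finite T" and Union_T: "\<Union>T = {X..X + w} \<times> {Y..Y + h}"
  using tiling unfolding square_tiling_def by auto

lemma mem_tile: "S \<in> T \<Longrightarrow> (x, y) \<in> S \<longleftrightarrow>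
    left S \<le> x \<and> x \<le> left S + side S \<and> bot S \<le> y \<and> y \<le> top S"
  using tile_eq[of S] unfolding top_def by (metis atLeastAtMost_iff mem_Sigma_iff)

lemma tile_bounds:
  assumes "S \<in> T"
  shows "X \<le> left S" "left S + side S \<le> X + w" "Y \<le> bot S" "top S \<le> Y + h" "bot S < top S"
proof -
  have s: "0 < side S" using side_pos assms .
  then have "(left S, bot S) \<in> S" "(left S + side S, top S) \<in> S"
    using mem_tile[OF assms] by (auto simp: top_def)
  then have "(left S, bot S) \<in> {X..X + w} \<times> {Y..Y + h}"
    "(left S + side S, top S) \<in> {X..X + w} \<times> {Y..Y + h}"
    unfolding Union_T[symmetric] using assms by blast+
  then show "X \<le> left S" "left S + side S \<le> X + w" "Y \<le> bot S" "top S \<le> Y + h" "bot S < top S"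
    using s by (auto simp: top_def)
qed

lemma tiles_disjoint:
  assumes "S \<in> T" "S' \<in> T" "S \<noteq> S'" "bot S < y" "y < top S" "bot S' < y" "y < top S'"
  shows "{left S<..<left S + side S} \<inter> {left S'<..<left S' + side S'} = {}"
proof -
  have int: "interior S = {left S<..<left S + side S} \<times> {bot S<..<top S}" if "S \<in> T" for S
    using tile_eq[OF that] interior_rectangle unfolding top_def by metis
  have "interior S \<inter> interior S' = {}"
    using tiling assms unfolding square_tiling_def pairwise_def by blast
  then show ?thesis using int assms by fastforce
qed

text \<open>A generic line meets each tile in its interior or not at all. The sections then overlap
  only in end points, so their lengths add up to the width.\<close>

lemma slice:
  assumes y: "Y < y" "y < Y + h" and generic: "y \<notin> bot ` T \<union> top ` T"
  shows "(\<Sum>S | S \<in> T \<and> bot S < y \<and> y < top S. side S) = w"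
proof -
  let ?A = "{S \<in> T. bot S < y \<and> y < top S}"
  let ?f = "\<lambda>S. {left S..left S + side S}"
  have "(\<Union>S\<in>?A. ?f S) = {X..X + w}"
  proof
    show "(\<Union>S\<in>?A. ?f S) \<subseteq> {X..X + w}" using tile_bounds by fastforce
    show "{X..X + w} \<subseteq> (\<Union>S\<in>?A. ?f S)"
    proof
      fix x assume "x \<in> {X..X + w}"
      with y have "(x, y) \<in> \<Union>T" unfolding Union_T by auto
      then obtain S where S: "S \<in> T" "(x, y) \<in> S" by blast
      moreover from S have "bot S \<noteq> y" "top S \<noteq> y" using generic by auto
      ultimately show "x \<in> (\<Union>S\<in>?A. ?f S)" using mem_tile[of S x y] by force
    qed
  qed
  moreover have "measure lebesgue (\<Union>S\<in>?A. ?f S) = (\<Sum>S\<in>?A. measure lebesgue (?f S))"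
  proof (rule measure_negligible_finite_Union_image)
    show "pairwise (\<lambda>S S'. negligible (?f S \<inter> ?f S')) ?A"
    proof (rule pairwiseI)
      fix S S' assume "S \<in> ?A" "S' \<in> ?A" "S \<noteq> S'"
      then show "negligible (?f S \<inter> ?f S')"
        by (intro negligible_Int_adjacent_intervals tiles_disjoint[of S S' y]) auto
    qed
  qed (use finite_T in auto)
  moreover have "(\<Sum>S\<in>?A. measure lebesgue (?f S)) = (\<Sum>S\<in>?A. side S)"
    using side_pos by (intro sum.cong refl) (simp add: less_imp_le)
  ultimately show ?thesis using w_pos by simp
qed

text \<open>Moving the line slightly down or up makes it generic, and the half-open conditions at
  \<open>v\<close> select exactly the tiles that the moved line crosses.\<close>

lemma slice_at_level:
  shows "Y < v \<Longrightarrow> v \<le> Y + h \<Longrightarrow> (\<Sum>S | S \<in> T \<and> bot S < v \<and> v \<le> top S. side S) = w"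
    and "Y \<le> v \<Longrightarrow> v < Y + h \<Longrightarrow> (\<Sum>S | S \<in> T \<and> bot S \<le> v \<and> v < top S. side S) = w"
proof -
  let ?V = "bot ` T \<union> top ` T \<union> {Y, Y + h}"
  \<comment> \<open>The \<open>1\<close> makes \<open>D\<close> nonempty without a case distinction;
    half of the minimum stays below the distance from \<open>v\<close> to any other level.\<close>
  define D where "D = insert 1 ((\<lambda>u. \<bar>u - v\<bar>) ` (?V - {v}))"
  have "finite D" unfolding D_def using finite_T by simp
  moreover have "D \<noteq> {}" unfolding D_def by simp
  ultimately obtain m where m: "m \<in> D" "\<And>x. x \<in> D \<Longrightarrow> m \<le> x" using Min_in Min_le by metis
  from m(1) have "0 < m" unfolding D_def by auto
  define \<delta> where "\<delta> = m / 2"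
  have \<delta>: "0 < \<delta>" using \<open>0 < m\<close> by (simp add: \<delta>_def)
  have \<delta>_less: "\<delta> < \<bar>u - v\<bar>" if "u \<in> ?V - {v}" for u
  proof -
    have "m \<le> \<bar>u - v\<bar>" using that by (intro m(2)) (simp add: D_def)
    with \<open>0 < m\<close> show "\<delta> < \<bar>u - v\<bar>" by (simp add: \<delta>_def)
  qed
  have far: "u = v \<or> u + \<delta> < v \<or> v + \<delta> < u" if "u \<in> ?V" for u
    using \<delta>_less[of u] that by (auto simp: abs_if split: if_splits)
  {
    assume v: "Y < v" "v \<le> Y + h"
    have "{S \<in> T. bot S < v \<and> v \<le> top S} = {S \<in> T. bot S < v - \<delta> \<and> v - \<delta> < top S}"
    proof (intro Collect_cong conj_cong refl)
      fix S assume "S \<in> T"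
      then show "bot S < v \<longleftrightarrow> bot S < v - \<delta>" "v \<le> top S \<longleftrightarrow> v - \<delta> < top S"
        using far[of "bot S"] far[of "top S"] \<delta> by auto
    qed
    moreover have "v - \<delta> \<notin> bot ` T \<union> top ` T" using far[of "v - \<delta>"] \<delta> by auto
    moreover have "Y < v - \<delta>" using far[of Y] v \<delta> by auto
    ultimately show "(\<Sum>S | S \<in> T \<and> bot S < v \<and> v \<le> top S. side S) = w"
      using slice[of "v - \<delta>"] v \<delta> by simp
  }
  {
    assume v: "Y \<le> v" "v < Y + h"
    have "{S \<in> T. bot S \<le> v \<and> v < top S} = {S \<in> T. bot S < v + \<delta> \<and> v + \<delta> < top S}"
    proof (intro Collect_cong conj_cong refl)
      fix S assume "S \<in> T"
      then show "bot S \<le> v \<longleftrightarrow> bot S < v + \<delta>" "v < top S \<longleftrightarrow> v + \<delta> < top S"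
        using far[of "bot S"] far[of "top S"] \<delta> by auto
    qed
    moreover have "v + \<delta> \<notin> bot ` T \<union> top ` T" using far[of "v + \<delta>"] \<delta> by auto
    moreover have "v + \<delta> < Y + h" using far[of "Y + h"] v \<delta> by auto
    ultimately show "(\<Sum>S | S \<in> T \<and> bot S \<le> v \<and> v < top S. side S) = w"
      using slice[of "v + \<delta>"] v \<delta> by simp
  }
qed

text \<open>Kirchhoff's law: the slices just below and just above \<open>v\<close> have equal width,
  and the tiles that cross \<open>v\<close> cancel. At the top and bottom edges only one of the two
  slices exists.\<close>

lemma level_balance:
  assumes "Y \<le> v" "v \<le> Y + h"
  shows "(\<Sum>S | S \<in> T \<and> top S = v. side S) - (\<Sum>S | S \<in> T \<and> bot S = v. side S) =
    (if v = Y + h then w else if v = Y then - w else 0)"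
proof -
  let ?M = "\<Sum>S | S \<in> T \<and> bot S < v \<and> v < top S. side S"
  have "{S \<in> T. bot S < v \<and> v \<le> top S} = {S \<in> T. bot S < v \<and> v < top S} \<union> {S \<in> T. top S = v}"
    using tile_bounds by fastforce
  then have one: "(\<Sum>S | S \<in> T \<and> bot S < v \<and> v \<le> top S. side S) = ?M + (\<Sum>S | S \<in> T \<and> top S = v. side S)"
    using finite_T by (simp only:) (subst sum.union_disjoint, auto)
  have "{S \<in> T. bot S \<le> v \<and> v < top S} = {S \<in> T. bot S < v \<and> v < top S} \<union> {S \<in> T. bot S = v}"
    using tile_bounds by fastforce
  then have two: "(\<Sum>S | S \<in> T \<and> bot S \<le> v \<and> v < top S. side S) = ?M + (\<Sum>S | S \<in> T \<and> bot S = v. side S)"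
    using finite_T by (simp only:) (subst sum.union_disjoint, auto)
  have none: "{S \<in> T. bot S < Y \<and> Y \<le> top S} = {}" "{S \<in> T. bot S \<le> Y + h \<and> Y + h < top S} = {}"
    using tile_bounds by fastforce+
  consider "v = Y + h" | "v = Y" | "Y < v" "v < Y + h" using assms by linarith
  then show ?thesis
  proof cases
    case 1
    then show ?thesis using one two slice_at_level(1)[of v] h_pos none(2) by simp
  next
    case 2
    then show ?thesis using one two slice_at_level(2)[of v] h_pos none(1) by simp
  next
    case 3
    then show ?thesis using one two slice_at_level[of v] by simp
  qed
qed

lemma width_height_forests: "\<exists>(K::int) (D::nat). (0::nat) < D \<and> D \<le> (2::nat) ^ card T \<and> h * K = w * D"
proof -
  define I where "I = (bot ` T \<union> top ` T) - {Y, Y + h}"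
  interpret net: level_network T top bot I
  proof
    show "finite T" by (rule finite_T)
    show "finite I" unfolding I_def using finite_T by simp
    show "bot S < top S" if "S \<in> T" for S using tile_bounds that by blast
    \<comment> \<open>At an inner height where no tile ends, the tiles that begin there would give a
      nonzero balance.\<close>
    show "\<exists>S\<in>T. top S = v" if "v \<in> I" for v
    proof (rule ccontr)
      assume no: "\<not> ?thesis"
      then have "v \<in> bot ` T" using that unfolding I_def by blast
      then obtain S where S: "S \<in> T" "bot S = v" by blast
      have v: "Y \<le> v" "v \<le> Y + h" "v \<noteq> Y" "v \<noteq> Y + h"
        using tile_bounds[OF S(1)] S(2) that unfolding I_def by auto
      have e: "{S \<in> T. top S = v} = {}" using no by blast
      have "0 < (\<Sum>S | S \<in> T \<and> bot S = v. side S)"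
        using finite_T S side_pos by (intro sum_pos) auto
      with level_balance[OF v(1,2)] v(3,4) show False unfolding e by simp
    qed
  qed
  have ends: "top ` T \<union> bot ` T \<subseteq> insert (Y + h) (insert Y I)"
    unfolding I_def by auto
  have range: "Y \<le> v \<and> v \<le> Y + h" if "v \<in> insert (Y + h) (insert Y I)" for v
    using that h_pos tile_bounds unfolding I_def by fastforce
  have "\<exists>K::int. ((Y + h) - Y) * K = w * card net.forests"
  proof (rule net.forest_green[where h = "\<lambda>v. v"])
    fix v assume v: "v \<in> insert (Y + h) (insert Y I)"
    have d: "top S - bot S = side S" for S by (simp add: top_def)
    show "(\<Sum>S | S \<in> T \<and> top S = v. top S - bot S) - (\<Sum>S | S \<in> T \<and> bot S = v. top S - bot S)
        = (if v = Y + h then w else if v = Y then - w else 0)"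
      unfolding d using level_balance range[OF v] by blast
  qed (use ends h_pos in \<open>auto simp: I_def\<close>)
  moreover have "0 < card net.forests"
    using net.forests_nonempty net.finite_forests by (simp add: card_gt_0_iff)
  ultimately show ?thesis using net.card_forests_le by auto
qed

text \<open>The vertical projections of the tiles cover the height, and each has length at most
  \<open>w\<close>.\<close>

lemma height_le: "h \<le> w * card T"
proof -
  let ?f = "\<lambda>S. {bot S..top S}"
  have sub: "{Y..Y + h} \<subseteq> (\<Union>S\<in>T. ?f S)"
  proof
    fix y assume "y \<in> {Y..Y + h}"
    then have "(X, y) \<in> \<Union>T" unfolding Union_T using w_pos by auto
    then show "y \<in> (\<Union>S\<in>T. ?f S)" using mem_tile by fastforce
  qed
  have "h = measure lebesgue {Y..Y + h}" using h_pos by simp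
  also have "\<dots> \<le> measure lebesgue (\<Union>S\<in>T. ?f S)"
    using sub finite_T by (intro measure_mono_fmeasurable) (auto intro!: fmeasurable.finite_UN)
  also have "\<dots> \<le> (\<Sum>S\<in>T. measure lebesgue (?f S))"
    using finite_T by (intro measure_UNION_le) auto
  also have "\<dots> \<le> (\<Sum>S\<in>T. w)"
  proof (rule sum_mono)
    fix S assume S: "S \<in> T"
    show "measure lebesgue (?f S) \<le> w"
      using tile_bounds[OF S] side_pos[OF S] by (simp add: top_def)
  qed
  finally show ?thesis by (simp add: mult.commute)
qed

end

section \<open>The lower bound for arbitrary tilings\<close>

lemma tiled_rectangleE:
  assumes "square_tiling T ({X..X + w} \<times> {Y..Y + h})" "0 < w" "0 < h"
  obtains left bot side where "tiled_rectangle T X Y w h left bot side"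
proof -
  have "\<forall>S\<in>T. \<exists>s x y. 0 < s \<and> S = {x..x + s} \<times> {y..y + s}"
    using assms(1) unfolding square_tiling_def is_square_def is_rectangle_def by blast
  then obtain side left bot where
    "\<And>S. S \<in> T \<Longrightarrow> 0 < side S \<and> S = {left S..left S + side S} \<times> {bot S..bot S + side S}"
    by metis
  then have "tiled_rectangle T X Y w h left bot side"
    unfolding tiled_rectangle_def using assms by blast
  then show thesis by (rule that)
qed

theorem card_square_tiling_ge:
  fixes p q :: nat
  assumes "0 < p" "0 < q" "coprime p q" "is_rectangle p q R" "square_tiling T R"
  shows "real q / real p \<le> card T" "log 2 q \<le> card T"
proof -
  obtain X Y where "R = {X..X + real p} \<times> {Y..Y + real q}"
    using assms(4) unfolding is_rectangle_def by blast
  with assms(5) have "square_tiling T ({X..X + real p} \<times> {Y..Y + real q})" by simp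
  then obtain left bot side where "tiled_rectangle T X Y p q left bot side"
    using assms(1,2) by (elim tiled_rectangleE) auto
  then interpret tiled_rectangle T X Y p q left bot side .
  show "real q / real p \<le> card T" using height_le assms(1) by (simp add: pos_divide_le_eq mult.commute)
  obtain K :: int and D :: nat where D: "0 < D" "D \<le> 2 ^ card T" and KD: "real q * K = real p * D"
    using width_height_forests by blast
  from KD have "real_of_int (int q * K) = real_of_int (int p * int D)" by simp
  then have "int q * K = int p * int D" by (simp only: of_int_eq_iff)
  then have "int q dvd int p * int D" using dvd_triv_left[of "int q" K] by simp
  then have "int q dvd int (p * D)" by simp
  then have "q dvd p * D" by (simp only: int_dvd_int_iff)
  then have "q dvd D" using assms(3) by (simp add: coprime_commute coprime_dvd_mult_right_iff)
  with D have "q \<le> 2 ^ card T" using dvd_imp_le order_trans by blast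
  then have "real q \<le> real (2 ^ card T)" by (simp only: of_nat_le_iff)
  then have "real q \<le> 2 powr card T" by (simp add: powr_realpow)
  then show "log 2 q \<le> card T" using assms(2) by (subst log_le_iff) auto
qed

subsection \<open>Combining tilings\<close>

text \<open>The asymmetric condition suits building up a union piece by piece: only the interior of
  the newly added rectangle has to be computed.\<close>

lemma square_tiling_Un:
  assumes 1: "square_tiling T1 R1" and 2: "square_tiling T2 R2" and disj: "R1 \<inter> interior R2 = {}"
  shows "square_tiling (T1 \<union> T2) (R1 \<union> R2)"
proof -
  have mixed: "interior S \<inter> interior S' = {}" if "S \<in> T1" "S' \<in> T2" for S S'
  proof -
    have "S \<subseteq> R1" "S' \<subseteq> R2" using 1 2 that unfolding square_tiling_def by auto
    then have "interior S \<subseteq> R1" "interior S' \<subseteq> interior R2"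
      using interior_subset interior_mono by blast+
    then show ?thesis using disj by blast
  qed
  have pw: "pairwise (\<lambda>S S'. interior S \<inter> interior S' = {}) T1"
    "pairwise (\<lambda>S S'. interior S \<inter> interior S' = {}) T2"
    using 1 2 unfolding square_tiling_def by auto
  have "pairwise (\<lambda>S S'. interior S \<inter> interior S' = {}) (T1 \<union> T2)"
  proof (rule pairwiseI)
    fix S S' assume ne: "S \<noteq> S'" and "S \<in> T1 \<union> T2" "S' \<in> T1 \<union> T2"
    then consider "S \<in> T1" "S' \<in> T1" | "S \<in> T2" "S' \<in> T2" | "S \<in> T1" "S' \<in> T2"
      | "S \<in> T2" "S' \<in> T1" by blast
    then show "interior S \<inter> interior S' = {}"
      using pairwiseD[OF pw(1) _ _ ne] pairwiseD[OF pw(2) _ _ ne] mixed[of S S'] mixed[of S' S]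
      by cases (simp_all add: Int_commute)
  qed
  then show ?thesis using 1 2 unfolding square_tiling_def by auto
qed

lemma square_tiling_image:
  assumes T: "square_tiling T R" and f: "linear f" "inj f"
    and sq: "\<And>s S. is_square s S \<Longrightarrow> is_square (c * s) (f ` S)"
  shows "square_tiling ((`) f ` T) (f ` R)"
  unfolding square_tiling_def
proof (intro conjI)
  show "finite ((`) f ` T)" using T unfolding square_tiling_def by simp
  show "\<forall>S\<in>(`) f ` T. \<exists>s. is_square s S" using T sq unfolding square_tiling_def by blast
  show "\<Union> ((`) f ` T) = f ` R" using T unfolding square_tiling_def by blast
  show "pairwise (\<lambda>S S'. interior S \<inter> interior S' = {}) ((`) f ` T)"
    unfolding pairwise_def
  proof (intro ballI impI)
    fix A B assume "A \<in> (`) f ` T" "B \<in> (`) f ` T" "A \<noteq> B"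
    then obtain S S' where S: "S \<in> T" "S' \<in> T" "S \<noteq> S'" "A = f ` S" "B = f ` S'" by blast
    then have "interior S \<inter> interior S' = {}"
      using T unfolding square_tiling_def pairwise_def by blast
    then show "interior A \<inter> interior B = {}"
      unfolding S interior_injective_linear_image[OF f] using f(2) by (simp flip: image_Int)
  qed
qed

definition covers :: "(real \<times> real) set \<Rightarrow> nat \<Rightarrow> bool" where
  "covers R N \<longleftrightarrow> (\<exists>T. square_tiling T R \<and> integer_sided T \<and> card T \<le> N)"

text \<open>Quantifying over all positions lets a tiling be placed directly wherever a larger
  rectangle has room for it.\<close>

definition tileable :: "nat \<Rightarrow> nat \<Rightarrow> nat \<Rightarrow> bool" where
  "tileable w h N \<longleftrightarrow> (\<forall>x y. covers ({x..x + real w} \<times> {y..y + real h}) N)"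

lemma tileable_covers:
  assumes "tileable w h N" "x' = x + real w" "y' = y + real h"
  shows "covers ({x..x'} \<times> {y..y'}) N"
  using assms unfolding tileable_def by blast

lemma tileableI: "(\<And>x y. covers ({x..x + real w} \<times> {y..y + real h}) N) \<Longrightarrow> tileable w h N"
  unfolding tileable_def by blast

lemma covers_Un:
  assumes "covers R1 M" "covers R2 N" "R1 \<inter> interior R2 = {}"
  shows "covers (R1 \<union> R2) (M + N)"
proof -
  obtain T1 T2 where T: "square_tiling T1 R1" "integer_sided T1" "card T1 \<le> M"
    "square_tiling T2 R2" "integer_sided T2" "card T2 \<le> N"
    using assms unfolding covers_def by blast
  have "card (T1 \<union> T2) \<le> M + N" using T card_Un_le[of T1 T2] by linarith
  moreover have "integer_sided (T1 \<union> T2)" using T unfolding integer_sided_def by blast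
  ultimately show ?thesis using square_tiling_Un T assms(3) unfolding covers_def by blast
qed

lemma covers_image:
  assumes R: "covers R N" and f: "linear f" "inj f" and c: "0 < (c::nat)"
    and sq: "\<And>s S. is_square s S \<Longrightarrow> is_square (c * s) (f ` S)"
  shows "covers (f ` R) N"
proof -
  obtain T where T: "square_tiling T R" "integer_sided T" "card T \<le> N"
    using R unfolding covers_def by blast
  have "integer_sided ((`) f ` T)"
    unfolding integer_sided_def
  proof
    fix A assume "A \<in> (`) f ` T"
    then obtain S n where "A = f ` S" "0 < (n::nat)" "is_square n S"
      using T(2) unfolding integer_sided_def by blast
    then show "\<exists>n>0. is_square (real n) A" using sq[of n S] c
      by (intro exI[of _ "c * n"]) simp
  qed
  moreover have "card ((`) f ` T) \<le> N"
    using T card_image_le[of T "(`) f"] unfolding square_tiling_def by linarith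
  ultimately show ?thesis using square_tiling_image[OF T(1) f sq] unfolding covers_def by blast
qed

lemma tileable_square: "0 < n \<Longrightarrow> tileable n n 1"
proof (rule tileableI)
  fix x y :: real assume n: "0 < n"
  let ?R = "{x..x + real n} \<times> {y..y + real n}"
  have "is_square n ?R" using n unfolding is_square_def is_rectangle_def by auto
  then have "square_tiling {?R} ?R" "integer_sided {?R}"
    using n unfolding square_tiling_def integer_sided_def by auto
  then show "covers ?R 1" unfolding covers_def by (intro exI[of _ "{?R}"]) simp
qed

lemma tileable_above:
  assumes "tileable w h M" "tileable w k N"
  shows "tileable w (h + k) (M + N)"
proof (rule tileableI)
  fix x y :: real
  have "covers (({x..x + real w} \<times> {y..y + real h}) \<union>
      ({x..x + real w} \<times> {y + real h..y + real (h + k)})) (M + N)"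
    using assms by (intro covers_Un tileable_covers) (auto simp: interior_rectangle)
  moreover have "({x..x + real w} \<times> {y..y + real h}) \<union>
      ({x..x + real w} \<times> {y + real h..y + real (h + k)}) = {x..x + real w} \<times> {y..y + real (h + k)}"
    by auto
  ultimately show "covers ({x..x + real w} \<times> {y..y + real (h + k)}) (M + N)" by simp
qed

lemma tileable_swap:
  assumes "tileable w h N"
  shows "tileable h w N"
proof (rule tileableI)
  fix x y :: real
  have "covers (prod.swap ` ({y..y + real w} \<times> {x..x + real h})) N"
  proof (rule covers_image[where c = 1])
    show "covers ({y..y + real w} \<times> {x..x + real h}) N" using assms by (intro tileable_covers) auto
    show "linear (prod.swap :: real \<times> real \<Rightarrow> real \<times> real)"
      by (intro linearI) (auto simp: prod.swap_def)
    show "is_square (real 1 * s) (prod.swap ` S)" if sq: "is_square s S" for s S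
    proof -
      obtain u v where "0 < s" "S = {u..u + s} \<times> {v..v + s}"
        using sq unfolding is_square_def is_rectangle_def by blast
      then have "0 < s" "prod.swap ` S = {v..v + s} \<times> {u..u + s}" by (auto simp: product_swap)
      then show ?thesis unfolding is_square_def is_rectangle_def by auto
    qed
  qed auto
  then show "covers ({x..x + real h} \<times> {y..y + real w}) N" by (simp add: product_swap)
qed

lemma tileable_beside:
  assumes "tileable w h M" "tileable v h N"
  shows "tileable (w + v) h (M + N)"
  using tileable_swap[OF tileable_above[OF tileable_swap[OF assms(1)] tileable_swap[OF assms(2)]]] .

lemma scaleR_image_rectangle:
  fixes c :: real
  assumes "0 < c"
  shows "(\<lambda>z. c *\<^sub>R z) ` ({x..x + w} \<times> {y..y + h}) = {c * x..c * x + c * w} \<times> {c * y..c * y + c * h}"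
proof -
  have "(\<lambda>z. c *\<^sub>R z) ` ({x..x + w} \<times> {y..y + h}) =
      ((*) c ` {x..x + w}) \<times> ((*) c ` {y..y + h})"
    by (force simp: image_iff)
  then show ?thesis using assms by (simp add: distrib_left)
qed

lemma tileable_scale:
  assumes "tileable w h N" and c: "0 < c"
  shows "tileable (c * w) (c * h) N"
proof (rule tileableI)
  fix x y :: real
  let ?f = "\<lambda>z :: real \<times> real. real c *\<^sub>R z"
  have "covers (?f ` ({x / c..x / c + real w} \<times> {y / c..y / c + real h})) N"
  proof (rule covers_image[where c = c])
    show "covers ({x / c..x / c + real w} \<times> {y / c..y / c + real h}) N"
      using assms by (intro tileable_covers) auto
    show "linear ?f" by (rule linear_scaleR)
    show "inj ?f" using c by (simp add: inj_on_def)
    show "is_square (real c * s) (?f ` S)" if sq: "is_square s S" for s S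
    proof -
      obtain u v where "0 < s" "S = {u..u + s} \<times> {v..v + s}"
        using sq unfolding is_square_def is_rectangle_def by blast
      then show ?thesis
        using c scaleR_image_rectangle[of "real c" u s v s] unfolding is_square_def is_rectangle_def
        by auto
    qed
  qed (rule c)
  then show "covers ({x..x + real (c * w)} \<times> {y..y + real (c * h)}) N"
    using c scaleR_image_rectangle[of "real c" "x / c" w "y / c" h] by simp
qed

text \<open>Three squares of sides \<open>m + k + e\<close>, \<open>m + k\<close>, \<open>m + 2 * k + e\<close> in three corners; they leave
  a rectangle in the fourth corner and a small one in the middle.\<close>

lemma tileable_pinwheel:
  assumes k: "0 < k" and e: "0 < e" and m: "0 < m"
    and mid: "tileable k e M" and rest: "tileable m (m + 2 * (k + e)) N"
  shows "tileable (2 * m + 2 * k + e) (2 * m + 3 * k + 2 * e) (3 + M + N)"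
proof (rule tileableI)
  fix x y :: real
  define a b c where "a = real (m + k + e)" and "b = real (m + k)" and "c = real (m + 2 * k + e)"
  have abc: "0 < b" "b < a" "a < c" "c < a + b"
    using k e m by (auto simp: a_def b_def c_def)
  let ?A = "{x..x + a} \<times> {y..y + a}"
  let ?B = "{x + a..x + a + b} \<times> {y..y + b}"
  let ?C = "{x..x + c} \<times> {y + a..y + a + c}"
  \<comment> \<open>\<open>?C\<close> overhangs \<open>?A\<close> by \<open>k\<close>, and
    \<open>?A\<close> is higher than \<open>?B\<close> by \<open>e\<close>; this leaves the gap
    \<open>?K\<close>.\<close>
  let ?K = "{x + a..x + c} \<times> {y + b..y + a}"
  let ?R = "{x + c..x + a + b} \<times> {y + b..y + a + c}"
  have "covers ?A 1"
    by (rule tileable_covers[OF tileable_square[of "m + k + e"]]) (use k in \<open>auto simp: a_def\<close>)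
  moreover have "covers ?B 1"
    by (rule tileable_covers[OF tileable_square[of "m + k"]]) (use k in \<open>auto simp: b_def\<close>)
  ultimately have "covers (?A \<union> ?B) (1 + 1)"
    by (rule covers_Un) (auto simp: interior_rectangle)
  moreover have "covers ?C 1"
    by (rule tileable_covers[OF tileable_square[of "m + 2 * k + e"]]) (use k in \<open>auto simp: c_def\<close>)
  ultimately have "covers (?A \<union> ?B \<union> ?C) (1 + 1 + 1)"
    by (rule covers_Un) (use abc in \<open>auto simp: interior_rectangle\<close>)
  moreover have "covers ?K M"
    by (rule tileable_covers[OF mid]) (auto simp: a_def b_def c_def)
  ultimately have "covers (?A \<union> ?B \<union> ?C \<union> ?K) (1 + 1 + 1 + M)"
    by (rule covers_Un) (use abc in \<open>auto simp: interior_rectangle\<close>)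
  moreover have "covers ?R N"
    by (rule tileable_covers[OF rest]) (auto simp: a_def b_def c_def)
  ultimately have "covers (?A \<union> ?B \<union> ?C \<union> ?K \<union> ?R) (1 + 1 + 1 + M + N)"
    by (rule covers_Un) (use abc in \<open>auto simp: interior_rectangle\<close>)
  moreover have "?A \<union> ?B \<union> ?C \<union> ?K \<union> ?R = {x..x + (a + b)} \<times> {y..y + (a + c)}" (is "?L = ?box")
  proof
    show "?L \<subseteq> ?box" using abc by auto
    show "?box \<subseteq> ?L"
    proof
      fix z assume z: "z \<in> ?box"
      obtain u v where uv: "z = (u, v)" by (cases z)
      show "z \<in> ?L" using z abc unfolding uv
        by (cases "u \<le> x + a"; cases "v \<le> y + a"; cases "u \<le> x + c"; cases "v \<le> y + b") simp_all
    qed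
  qed
  moreover have "1 + 1 + 1 + M + N = 3 + M + N" by simp
  moreover have "a + b = real (2 * m + 2 * k + e)" "a + c = real (2 * m + 3 * k + 2 * e)"
    by (auto simp: a_def b_def c_def)
  ultimately show "covers ({x..x + real (2 * m + 2 * k + e)} \<times> {y..y + real (2 * m + 3 * k + 2 * e)}) (3 + M + N)"
    by (simp only:)
qed

subsection \<open>Rectangles that are almost squares\<close>

text \<open>The constant \<open>2\<close> is what the rectangle \<open>1\<close> by \<open>2\<close>
  costs, where both logarithms vanish. The coefficients are matched to
  \<open>budget_middle\<close>.\<close>

definition budget :: "nat \<Rightarrow> nat \<Rightarrow> real" where
  "budget n d = 400 * log 2 n + 6 * log 2 d + 2"

definition thrifty :: "nat \<Rightarrow> nat \<Rightarrow> bool" where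
  "thrifty n d \<longleftrightarrow> (\<exists>N. tileable n (n + d) N \<and> real N \<le> budget n d)"

text \<open>The explicit powers of two reduce comparisons of logarithms up to integers to
  inequalities between naturals.\<close>

lemma log2_le:
  fixes a b :: nat
  assumes "0 < a" "a * 2 ^ i \<le> b * 2 ^ j"
  shows "log 2 a + i \<le> log 2 b + j"
proof -
  have "0 < b" using assms by (cases b) auto
  have "real (a * 2 ^ i) \<le> real (b * 2 ^ j)" using assms(2) by (simp only: of_nat_le_iff)
  then have "log 2 (real a * 2 ^ i) \<le> log 2 (real b * 2 ^ j)"
    using assms(1) \<open>0 < b\<close> by (subst log_le_cancel_iff) auto
  then show ?thesis using assms(1) \<open>0 < b\<close> by (simp add: log_mult log_nat_power)
qed

lemma tileable_cong:
  "tileable w h N \<Longrightarrow> w = w' \<Longrightarrow> h = h' \<Longrightarrow> N = N' \<Longrightarrow> tileable w' h' N'"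
  by simp

lemma log2_nat_nonneg: "0 \<le> log 2 (real n)"
  by (cases "n = 0") (auto simp: log_def)

section \<open>Reduction steps and their costs\<close>

lemma thrifty_square:
  assumes "0 < n"
  shows "thrifty n n"
proof -
  have "tileable n (n + n) (1 + 1)"
    using assms tileable_square by (intro tileable_above) auto
  then show ?thesis unfolding thrifty_def budget_def
    using log2_nat_nonneg[of n] by (intro exI[of _ 2]) (auto simp: numeral_2_eq_2)
qed

text \<open>Cutting off one square at least halves the difference, as \<open>d \<le> 2 * n\<close>;
  this frees \<open>6\<close> in the budget.\<close>

lemma thrifty_long:
  assumes "0 < n" "n < d" "d \<le> 2 * n" "thrifty n (d - n)"
  shows "thrifty n d"
proof -
  obtain N where N: "tileable n (n + (d - n)) N" "real N \<le> budget n (d - n)"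
    using assms(4) unfolding thrifty_def by blast
  then have "tileable n d N" using assms by simp
  then have t: "tileable n (n + d) (1 + N)"
    using assms tileable_square by (intro tileable_above) auto
  have "log 2 (d - n) + real 1 \<le> log 2 d + real 0" using assms by (intro log2_le) auto
  then have "real (1 + N) \<le> budget n d" using N(2) unfolding budget_def by simp
  with t show ?thesis unfolding thrifty_def by blast
qed

lemma tileable_strip: "0 < d \<Longrightarrow> tileable d (Suc a * d) (Suc a)"
proof (induction a)
  case 0
  then show ?case using tileable_square by simp
next
  case (Suc a)
  then have "tileable d (d + Suc a * d) (1 + Suc a)"
    using tileable_square by (intro tileable_above) auto
  then show ?case by simp
qed

text \<open>Cutting off the square of side \<open>n\<close> and then \<open>n div d - 1\<close>
  squares of side \<open>d\<close> leaves \<open>d\<close> by \<open>d + n mod d\<close>. At most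
  seven squares are used, and the gain is in \<open>n\<close> if \<open>n\<close> is at least about
  \<open>3 / 2 * d\<close>, in the difference otherwise.\<close>

lemma thrifty_euclid:
  assumes "0 < d" "d < n" "n < 8 * d" and IH: "0 < n mod d \<Longrightarrow> thrifty d (n mod d)"
  shows "thrifty n d"
proof -
  define a x where "a = n div d" and "x = n mod d"
  have n: "n = a * d + x" unfolding a_def x_def by simp
  have "x < d" using assms(1) unfolding x_def by simp
  have "0 < a" using assms(1,2) unfolding a_def by (simp add: div_greater_zero_iff)
  have "a < 8" using assms(3) unfolding a_def by (simp add: less_mult_imp_div_less)
  \<comment> \<open>The spare \<open>1\<close> is reserved for the square of side \<open>n\<close>,
    which is added at the end.\<close>
  have "\<exists>N. tileable d n N \<and> real N + 1 \<le> budget n d"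
  proof (cases "x = 0")
    case True
    obtain a' where a': "a = Suc a'" using \<open>0 < a\<close> by (cases a) auto
    have "tileable d n a" using tileable_strip[OF assms(1), of a'] n True a' by simp
    moreover have "2 \<le> a" using n True assms(2) \<open>0 < a\<close> by (cases "a = 1") auto
    have "log 2 (real 1) + real 1 \<le> log 2 n + real 0"
      using assms(1,2) by (intro log2_le) auto
    then have "real a + 1 \<le> budget n d"
      using \<open>a < 8\<close> log2_nat_nonneg[of d] unfolding budget_def by simp
    ultimately show ?thesis by blast
  next
    case False
    then obtain N where N: "tileable d (d + x) N" "real N \<le> budget d x"
      using IH unfolding thrifty_def x_def by auto
    have t: "tileable d n (N + (a - 1))"
    proof (cases "a = 1")
      case True
      then show ?thesis using N n by simp
    next
      case False
      then obtain a' where a': "a = Suc (Suc a')" using \<open>0 < a\<close> by (metis One_nat_def not0_implies_Suc not_gr_zero)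
      have "tileable d ((d + x) + Suc a' * d) (N + Suc a')"
        using tileable_above[OF N(1) tileable_strip[OF assms(1)]] .
      then show ?thesis using n a' by (simp add: algebra_simps)
    qed
    have xd: "log 2 x + real 0 \<le> log 2 d + real 0"
      using False \<open>x < d\<close> by (intro log2_le) auto
    have dn: "log 2 d + real 0 \<le> log 2 n + real 0" using assms(1,2) by (intro log2_le) auto
    consider "2 \<le> a" | "a = 1" "2 * x \<le> d" | "a = 1" "d < 2 * x" using \<open>0 < a\<close> by linarith
    then have "budget d x + real a \<le> budget n d"
    proof cases
      case 1
      then have "2 * d \<le> n" unfolding n by (intro trans_le_add1 mult_le_mono1)
      then have "log 2 d + real 1 \<le> log 2 n + real 0"
        using assms(1) by (intro log2_le) simp_all
      then show ?thesis using xd \<open>a < 8\<close> unfolding budget_def by simp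
    next
      case 2
      then have "log 2 x + real 1 \<le> log 2 d + real 0" using False by (intro log2_le) auto
      then show ?thesis using dn 2 unfolding budget_def by simp
    next
      case 3
      \<comment> \<open>As \<open>3 / 2\<close> exceeds the square root of \<open>2\<close>,
        comparing squares yields a gain of \<open>1 / 2\<close> in the logarithm.\<close>
      have "log 2 (d ^ 2) + real 1 \<le> log 2 (n ^ 2) + real 0"
      proof (rule log2_le)
        have "3 * d \<le> 2 * n" using 3 n by simp
        then have "(3 * d)\<^sup>2 \<le> (2 * n)\<^sup>2" by (rule power_mono) simp
        then show "d\<^sup>2 * 2 ^ 1 \<le> n\<^sup>2 * 2 ^ 0" by (simp add: power_mult_distrib)
      qed (use assms(1) in simp)
      then have "2 * log 2 d + 1 \<le> 2 * log 2 n"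
        using assms(1,2) by (simp add: log_nat_power)
      then show ?thesis using xd 3 unfolding budget_def by simp
    qed
    with t N(2) \<open>0 < a\<close> show ?thesis by (intro exI[of _ "N + (a - 1)"]) (auto simp: of_nat_diff)
  qed
  then obtain N where N: "tileable d n N" "real N + 1 \<le> budget n d" by blast
  have "tileable n (n + d) (1 + N)"
    using tileable_above[OF tileable_square tileable_swap[OF N(1)]] assms by simp
  then show ?thesis using N(2) unfolding thrifty_def by (intro exI[of _ "1 + N"]) simp
qed

lemma thrifty_double:
  assumes "0 < n" "0 < d" "thrifty n d"
  shows "thrifty (2 * n) (2 * d)"
proof -
  obtain N where N: "tileable n (n + d) N" "real N \<le> budget n d"
    using assms(3) unfolding thrifty_def by blast
  have "tileable (2 * n) (2 * n + 2 * d) N" using tileable_scale[OF N(1), of 2] by simp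
  moreover have "budget n d \<le> budget (2 * n) (2 * d)"
    using assms(1,2) unfolding budget_def by (simp add: log_mult)
  ultimately show ?thesis using N(2) unfolding thrifty_def by (meson order_trans)
qed

lemma budget_halve:
  assumes "0 < m" "0 < d" "2 * m \<le> n"
  shows "budget m (2 * d) + 4 \<le> budget n d"
proof -
  have "log 2 m + real 1 \<le> log 2 n + real 0" using assms by (intro log2_le) auto
  moreover have "log 2 (real (2 * d)) = 1 + log 2 d" using assms by (simp add: log_mult)
  ultimately show ?thesis unfolding budget_def by simp
qed

text \<open>Two squares of half the width lie side by side; above them a square of side
  \<open>m + 2 * d\<close> leaves \<open>m\<close> by \<open>m + 2 * d\<close>.\<close>

lemma thrifty_halve_width:
  assumes "0 < m" "0 < d" "thrifty m (2 * d)"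
  shows "thrifty (2 * m + 2 * d) d"
proof -
  obtain N where N: "tileable m (m + 2 * d) N" "real N \<le> budget m (2 * d)"
    using assms(3) unfolding thrifty_def by blast
  have sq: "tileable (m + d) (m + d) 1" "tileable (m + 2 * d) (m + 2 * d) 1"
    using assms tileable_square by auto
  have "tileable (2 * m + 2 * d) (m + d) 2"
    by (rule tileable_cong[OF tileable_beside[OF sq(1) sq(1)]]) auto
  moreover have "tileable (2 * m + 2 * d) (m + 2 * d) (1 + N)"
    by (rule tileable_cong[OF tileable_beside[OF sq(2) N(1)]]) auto
  ultimately have "tileable (2 * m + 2 * d) (2 * m + 2 * d + d) (3 + N)"
    by (rule tileable_cong[OF tileable_above]) auto
  moreover have "real (3 + N) \<le> budget (2 * m + 2 * d) d"
    using budget_halve[of m d "2 * m + 2 * d"] assms N(2) by simp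
  ultimately show ?thesis unfolding thrifty_def by blast
qed

text \<open>Two squares of half the height are stacked; beside them a square of side
  \<open>m\<close> leaves \<open>m\<close> by \<open>m + 2 * d\<close>.\<close>

lemma thrifty_halve_height:
  assumes "0 < m" "0 < d" "thrifty m (2 * d)"
  shows "thrifty (2 * m + d) d"
proof -
  obtain N where N: "tileable m (m + 2 * d) N" "real N \<le> budget m (2 * d)"
    using assms(3) unfolding thrifty_def by blast
  have sq: "tileable (m + d) (m + d) 1" "tileable m m 1"
    using assms tileable_square by auto
  have "tileable (m + d) (2 * m + 2 * d) 2"
    by (rule tileable_cong[OF tileable_above[OF sq(1) sq(1)]]) auto
  moreover have "tileable m (2 * m + 2 * d) (1 + N)"
    by (rule tileable_cong[OF tileable_above[OF sq(2) N(1)]]) auto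
  ultimately have "tileable (2 * m + d) (2 * m + d + d) (3 + N)"
    by (rule tileable_cong[OF tileable_beside]) auto
  moreover have "real (3 + N) \<le> budget (2 * m + d) d"
    using budget_halve[of m d "2 * m + d"] assms N(2) by simp
  ultimately show ?thesis unfolding thrifty_def by blast
qed

text \<open>In the pinwheel with \<open>k = e = d\<close> the middle rectangle is a single
  square.\<close>

lemma thrifty_twice_odd:
  assumes "0 < m" "0 < d" "thrifty m (4 * d)"
  shows "thrifty (2 * m + 3 * d) (2 * d)"
proof -
  obtain N where N: "tileable m (m + 4 * d) N" "real N \<le> budget m (4 * d)"
    using assms(3) unfolding thrifty_def by blast
  have "tileable (2 * m + 2 * d + d) (2 * m + 3 * d + 2 * d) (3 + 1 + N)"
    using assms N(1) by (intro tileable_pinwheel tileable_square) auto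
  then have "tileable (2 * m + 3 * d) (2 * m + 3 * d + 2 * d) (4 + N)"
    by (simp add: algebra_simps)
  moreover have "real (4 + N) \<le> budget (2 * m + 3 * d) (2 * d)"
    using budget_halve[of m "2 * d" "2 * m + 3 * d"] assms N(2) by simp
  ultimately show ?thesis unfolding thrifty_def by blast
qed

text \<open>With \<open>u = 2 * m / 2 ^ k\<close> the claim is
  \<open>400 * log 2 (1 / u) + 6 * log 2 (1 / (1 - u)) \<ge> 23\<close>; the first term suffices for
  \<open>u \<le> 15 / 16\<close>, the second one otherwise.\<close>

lemma budget_middle:
  assumes "0 < m" "0 < e" "2 * m + e = 2 ^ k"
  shows "400 * log 2 (real m) + 6 * log 2 (real e) + 23 \<le> 400 * (real k - 1) + 6 * real k"
proof -
  have m1: "log 2 m + real 1 \<le> log 2 (real 1) + real k" using assms by (intro log2_le) auto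
  have e0: "log 2 e + real 0 \<le> log 2 (real 1) + real k" using assms by (intro log2_le) auto
  show ?thesis
  \<comment> \<open>The two cases free \<open>6 * 4 = 24\<close> and
    \<open>400 / 16 = 25\<close>.\<close>
  proof (cases "16 * e \<le> 2 ^ k")
    case True
    then have "log 2 e + real 4 \<le> log 2 (real 1) + real k" using assms by (intro log2_le) auto
    then show ?thesis using m1 by simp
  next
    case False
    then have "real m * 32 \<le> 15 * 2 ^ k"
    proof -
      have "m * 32 \<le> 15 * 2 ^ k" using False assms(3) by linarith
      then have "real (m * 32) \<le> real (15 * 2 ^ k)" by (simp only: of_nat_le_iff)
      then show ?thesis by simp
    qed
    then have "real m \<le> (15/16) * 2 powr (real k - 1)"
      by (simp add: powr_diff powr_realpow)
    then have "log 2 (real m) \<le> log 2 ((15/16) * 2 powr (real k - 1))"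
      using assms(1) by (subst log_le_cancel_iff) auto
    also have "\<dots> = log 2 (15/16) + (real k - 1)"
      by (subst log_mult) simp_all
    also have "log 2 (15/16) \<le> - (1/16)"
    proof -
      have "ln (15/16::real) \<le> 15/16 - 1" by (rule ln_le_minus_one) simp
      moreover have "0 < ln (2::real)" "ln (2::real) \<le> 1" using ln_le_minus_one[of 2] by auto
      ultimately have "ln (15/16::real) \<le> - (1/16) * ln 2" by simp
      then show ?thesis using \<open>0 < ln (2::real)\<close> by (simp add: log_def pos_divide_le_eq)
    qed
    finally show ?thesis using e0 by simp
  qed
qed

text \<open>As \<open>d\<close> is invertible modulo \<open>M\<close>, the divisibility fixes the
  residue of \<open>b\<close>, and \<open>M\<close> consecutive numbers contain every
  residue.\<close>

lemma residue_in_window: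
  fixes M L n d :: nat
  assumes "0 < M" "coprime d M"
  obtains b where "L \<le> b" "b < L + M" "M dvd n + d * b"
proof -
  obtain c where c: "[d * c = 1] (mod M)" using cong_solve_coprime_nat[OF assms(2)] by auto
  define b where "b = L + nat ((- int n * int c - int L) mod int M)"
  have ib: "int b = int L + (- int n * int c - int L) mod int M"
    using assms(1) by (simp add: b_def)
  have "b < L + M" using assms(1) by (simp add: b_def nat_less_iff)
  have "[int d * int c = 1] (mod int M)"
    using c by (metis cong_int_iff of_nat_1 of_nat_mult)
  then have "[- int n * (int d * int c) = - int n * 1] (mod int M)" by (rule cong_scalar_left)
  moreover have "[int b = - int n * int c] (mod int M)"
    unfolding ib by (simp add: cong_def mod_simps)
  then have "[int d * int b = int d * (- int n * int c)] (mod int M)" by (rule cong_scalar_left)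
  ultimately have "[int d * int b = - int n] (mod int M)"
    by (simp add: cong_def algebra_simps)
  then have "int M dvd int d * int b - (- int n)" by (simp add: cong_iff_dvd_diff)
  then have "int M dvd int (n + d * b)" by (simp add: algebra_simps)
  then have "M dvd n + d * b" by (simp only: int_dvd_int_iff)
  with \<open>b < L + M\<close> show thesis by (intro that[of b]) (auto simp: b_def)
qed

text \<open>Here \<open>d\<close> is the difference divided by \<open>2 ^ k\<close>. The side \<open>d * b\<close> of the middle rectangle of the
  pinwheel is chosen so that the sides of the corner rectangle have the common factor \<open>2 ^ (k - 2)\<close>;
  removing this factor pays for the middle rectangle, which is \<open>d\<close> times
  \<open>(2 ^ k - b) \<times> b\<close>.\<close>

lemma thrifty_even_difference:
  assumes n: "odd n" and d: "odd d" and k: "2 \<le> k" and large: "8 * (2 ^ k * d) \<le> n"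
    and IH: "\<And>m e. 0 < m \<Longrightarrow> 0 < e \<Longrightarrow> e \<le> 2 * m \<Longrightarrow> m + e < n + 2 ^ k * d \<Longrightarrow> thrifty m e"
  shows "thrifty n (2 ^ k * d)"
proof -
  obtain j where k_eq: "k = j + 2" using k by (metis add.commute le_Suc_ex)
  define P where "P = (2::nat) ^ j"
  have P: "0 < P" "2 ^ k = 4 * P" "(2::nat) ^ (k - 1) = 2 * P"
    by (simp_all add: P_def k_eq)
  have dpos: "0 < d" using d by (rule odd_pos)
  have "coprime d (2 ^ (k - 1))" using d by simp
  then have "0 < 2 * P" "coprime d (2 * P)" using P(1) unfolding P(3) by simp_all
  \<comment> \<open>The window has length \<open>2 * P\<close> and is centred at
    \<open>2 * P\<close>. So neither \<open>b\<close> nor \<open>4 * P - b\<close> is below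
    \<open>P\<close>, which later gives \<open>e \<le> 2 * m\<close>.\<close>
  then obtain b where b: "P \<le> b" "b < P + 2 * P" "2 * P dvd n + d * b"
    by (rule residue_in_window)
  have "even (n + d * b)" using b(3) by (meson dvd_mult_left)
  \<comment> \<open>An odd \<open>b\<close> differs from \<open>2 * P\<close>, so the middle
    rectangle is not a square and \<open>e\<close> is positive.\<close>
  then have "odd b" using n d by simp
  define m where "m = min b (4 * P - b)"
  define e where "e = 4 * P - 2 * m"
  have "b \<noteq> 2 * P" using \<open>odd b\<close> by auto
  then have m: "P \<le> m" "m < 2 * P" using b by (auto simp: m_def)
  then have me: "0 < m" "0 < e" "2 * m + e = 2 ^ k" "e \<le> 2 * m"
    using P by (auto simp: e_def)
  have "m + e < n + 2 ^ k * d"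
  proof -
    have "2 ^ k * 1 \<le> 2 ^ k * d" using dpos by (intro mult_le_mono) auto
    then show ?thesis using me n odd_pos[OF n] by linarith
  qed
  then obtain M where M: "tileable m (m + e) M" "real M \<le> budget m e"
    using IH me unfolding thrifty_def by blast
  have "tileable (4 * P - b) b M"
  proof (cases "b \<le> 4 * P - b")
    case True
    then have "m = b" "m + e = 4 * P - b" using b by (auto simp: m_def e_def)
    then show ?thesis using tileable_swap[OF M(1)] by simp
  next
    case False
    then have "m = 4 * P - b" "m + e = b" using b by (auto simp: m_def e_def)
    then show ?thesis using M(1) by simp
  qed
  then have mid: "tileable (d * (4 * P - b)) (d * b) M" using dpos by (rule tileable_scale)
  obtain r where r: "n + d * b = 2 * P * r" using b(3) by blast
  \<comment> \<open>The width of the pinwheel forces its corner rectangle to have the shorter side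
    \<open>P * (r - 4 * d)\<close>.\<close>
  define s where "s = r - 4 * d"
  have r_ge: "16 * d \<le> r"
  proof -
    have "8 * (4 * P * d) \<le> 2 * P * r" using large r unfolding P(2) by linarith
    then have "2 * P * (16 * d) \<le> 2 * P * r" by (simp add: mult.assoc)
    then show ?thesis using P(1) by simp
  qed
  then have s: "0 < s" "8 * d \<le> 2 * s" "r = s + 4 * d" using dpos by (auto simp: s_def)
  have n_eq: "n = 2 * P * s + 2 * (d * (4 * P - b)) + d * b"
  proof -
    have "d * b + d * (4 * P - b) = 4 * P * d"
      using b by (simp flip: distrib_left)
    moreover have "n + d * b = 2 * P * s + 8 * P * d" using r s(3) by (simp add: algebra_simps)
    ultimately show ?thesis by (simp add: algebra_simps)
  qed
  have sn: "2 * P * s \<le> n" using n_eq by simp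
  have "s + 8 * d < n + 2 ^ k * d"
  proof -
    have "1 * s \<le> P * s" "1 * d \<le> P * d" using P(1) by (intro mult_le_mono; simp)+
    moreover have "2 * (P * s) \<le> n" "32 * (P * d) \<le> n"
      using sn large unfolding P(2) by (simp_all add: mult.assoc)
    ultimately have "s + 8 * d < n" using dpos by linarith
    then show ?thesis by simp
  qed
  then obtain N where N: "tileable s (s + 8 * d) N" "real N \<le> budget s (8 * d)"
    using IH[of s "8 * d"] s dpos unfolding thrifty_def by auto
  have "tileable (P * s) (P * s + 2 * (d * (4 * P - b) + d * b)) N"
  proof -
    have "tileable (P * s) (P * (s + 8 * d)) N" using tileable_scale[OF N(1) P(1)] .
    moreover have "P * (s + 8 * d) = P * s + 2 * (d * (4 * P - b) + d * b)"
      using b by (simp add: algebra_simps flip: distrib_left)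
    ultimately show ?thesis by simp
  qed
  then have "tileable (2 * (P * s) + 2 * (d * (4 * P - b)) + d * b)
      (2 * (P * s) + 3 * (d * (4 * P - b)) + 2 * (d * b)) (3 + M + N)"
    using mid b P s dpos by (intro tileable_pinwheel) auto
  moreover have "2 * (P * s) + 2 * (d * (4 * P - b)) + d * b = n" using n_eq by simp
  moreover have "2 * (P * s) + 3 * (d * (4 * P - b)) + 2 * (d * b) = n + 2 ^ k * d"
  proof -
    have "d * b + d * (4 * P - b) = 2 ^ k * d"
      using b P by (simp flip: distrib_left)
    then show ?thesis using n_eq mult.assoc[of 2 P s] by linarith
  qed
  ultimately have "tileable n (n + 2 ^ k * d) (3 + M + N)" by simp
  moreover have "real (3 + M + N) \<le> budget n (2 ^ k * d)"
  proof -
    have "log 2 s + real (k - 1) \<le> log 2 n + real 0"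
      using sn P(3) s(1) by (intro log2_le) (auto simp: algebra_simps)
    then have "log 2 s + (real k - 1) \<le> log 2 n" using k by (simp add: of_nat_diff)
    moreover have lg: "log 2 (real (2 ^ i * d)) = real i + log 2 d" for i
      using dpos by (simp add: log_mult log_nat_power)
    moreover have "log 2 (real (8 * d)) = 3 + log 2 d" using lg[of 3] by simp
    \<comment> \<open>The \<open>23\<close> of \<open>budget_middle\<close> is made up of the three
      squares, one surplus constant \<open>2\<close> and \<open>6 * log 2 8 = 18\<close> for the new
      difference \<open>8 * d\<close>. The gains are \<open>400 * (k - 1)\<close> from
      \<open>2 ^ (k - 1) * s \<le> n\<close> and \<open>6 * k\<close> from the power of two removed
      from the difference.\<close>
    ultimately show ?thesis
      using budget_middle[OF me(1-3)] M(2) N(2) unfolding budget_def by simp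
  qed
  ultimately show ?thesis unfolding thrifty_def by blast
qed

text \<open>Complete induction on the longer side. For \<open>8 * d \<le> n\<close> the parities
  select the step, and this bound keeps the new shorter side positive and the new difference at most
  twice as large.\<close>

lemma thrifty:
  assumes "0 < n" "0 < d" "d \<le> 2 * n"
  shows "thrifty n d"
  using assms
proof (induction "n + d" arbitrary: n d rule: less_induct)
  case less
  have IH: "thrifty m e" if "0 < m" "0 < e" "e \<le> 2 * m" "m + e < n + d" for m e
    using less.hyps that by blast
  have nd: "0 < n" "0 < d" "d \<le> 2 * n" using less.prems by auto
  consider "n < d" | "n = d" | "d < n" "n < 8 * d" | "8 * d \<le> n" by linarith
  then show ?case
  proof cases
    case 1
    have "thrifty n (d - n)" using 1 nd by (intro IH) auto
    with nd(1) 1 nd(3) show ?thesis by (rule thrifty_long)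
  next
    case 2
    then show ?thesis using nd thrifty_square by simp
  next
    case 3
    have "thrifty d (n mod d)" if "0 < n mod d"
      using that 3 nd mod_less_divisor[of d n] by (intro IH) linarith+
    with nd(2) 3 show ?thesis by (rule thrifty_euclid)
  next
    case large: 4
    show ?thesis
    proof (cases "even n")
      case True
      then obtain n' where n': "n = 2 * n'" by (elim evenE)
      show ?thesis
      proof (cases "even d")
        case True
        then obtain d' where d': "d = 2 * d'" by (elim evenE)
        have "thrifty n' d'" using nd n' d' by (intro IH) auto
        then show ?thesis using nd n' d' by (simp add: thrifty_double)
      next
        case False
        define m where "m = n' - d"
        have m: "n = 2 * m + 2 * d" "3 * d \<le> m" using large n' by (auto simp: m_def)
        have "thrifty m (2 * d)" using nd m by (intro IH) auto
        then show ?thesis using nd m by (simp add: thrifty_halve_width)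
      qed
    next
      case odd_n: False
      show ?thesis
      proof (cases "even d")
        case False
        then have "even (n - d)" using odd_n by simp
        then obtain m where "n - d = 2 * m" by (elim evenE)
        then have m: "n = 2 * m + d" "3 * d \<le> m" using large nd by auto
        have "thrifty m (2 * d)" using nd m by (intro IH) auto
        then show ?thesis using nd m by (simp add: thrifty_halve_height)
      next
        case True
        obtain d' where d: "d = 2 ^ multiplicity 2 d * d'" "odd d'"
          using multiplicity_decompose'[of d 2] nd by auto
        define k where "k = multiplicity 2 d"
        have dk: "d = 2 ^ k * d'" using d(1) by (simp add: k_def)
        have "k \<noteq> 0" using True dk d(2) by (cases k) auto
        then consider "k = 1" | "2 \<le> k" by linarith
        then show ?thesis
        proof cases
          case 1
          then have dd: "d = 2 * d'" using dk by simp
          have "even (n - 3 * d')" using odd_n d(2) by simp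
          then obtain m where "n - 3 * d' = 2 * m" by (elim evenE)
          then have m: "n = 2 * m + 3 * d'" "6 * d' \<le> m" using large dd nd by auto
          have "thrifty m (4 * d')" using nd m dd by (intro IH) auto
          then show ?thesis using nd m dd by (simp add: thrifty_twice_odd)
        next
          case 2
          have "thrifty n (2 ^ k * d')"
          proof (rule thrifty_even_difference[OF odd_n d(2) 2])
            show "8 * (2 ^ k * d') \<le> n" using large dk by simp
            show "thrifty m e" if "0 < m" "0 < e" "e \<le> 2 * m" "m + e < n + 2 ^ k * d'" for m e
              using that IH dk by simp
          qed
          then show ?thesis using dk by simp
        qed
      qed
    qed
  qed
qed

section \<open>The upper bound\<close>

text \<open>Cutting off \<open>q div p - 1\<close> squares of side \<open>p\<close> leaves an almost
  square rectangle. The case \<open>p = 1\<close> is separate, since \<open>log 2 p = 0\<close>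
  cannot absorb the constant of the budget.\<close>

theorem tileable_rectangle:
  fixes p q :: nat
  assumes "0 < p" "p < q" "coprime p q"
  shows "\<exists>N. tileable p q N \<and> real N \<le> real q / real p + 408 * log 2 (real p)"
proof (cases "p = 1")
  case True
  obtain a where "q = Suc a" using assms(2) by (cases q) auto
  then have "tileable p q q" using tileable_strip[of 1 a] True by simp
  then show ?thesis using True by (intro exI[of _ q]) simp
next
  case False
  define a x where "a = q div p" and "x = q mod p"
  have q: "q = a * p + x" unfolding a_def x_def by simp
  have "x < p" using assms(1) unfolding x_def by simp
  have "0 < a" using assms(1,2) unfolding a_def by (simp add: div_greater_zero_iff)
  have "0 < x"
  proof (rule ccontr)
    assume "\<not> 0 < x"
    then have "p dvd q" using q by simp
    then have "p dvd 1" using assms(3) by (metis coprime_absorb_left nat_dvd_1_iff_1)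
    then show False using False by simp
  qed
  have "thrifty p x" using assms(1) \<open>0 < x\<close> \<open>x < p\<close> by (intro thrifty) auto
  then obtain N where N: "tileable p (p + x) N" "real N \<le> budget p x"
    unfolding thrifty_def by blast
  have t: "tileable p q (N + (a - 1))"
  proof (cases "a = 1")
    case True
    then show ?thesis using N q by simp
  next
    case False
    then obtain a' where a': "a = Suc (Suc a')" using \<open>0 < a\<close> by (metis One_nat_def not0_implies_Suc not_gr_zero)
    have "tileable p ((p + x) + Suc a' * p) (N + Suc a')"
      using tileable_above[OF N(1) tileable_strip[OF assms(1)]] .
    then show ?thesis using q a' by (simp add: algebra_simps)
  qed
  have "log 2 x + real 0 \<le> log 2 p + real 0"
    using \<open>0 < x\<close> \<open>x < p\<close> by (intro log2_le) auto
  \<comment> \<open>For \<open>p \<ge> 2\<close> the constant \<open>2\<close> is at most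
    \<open>2 * log 2 p\<close>, which gives \<open>400 + 6 + 2 = 408\<close>.\<close>
  moreover have "log 2 (real 1) + real 1 \<le> log 2 p + real 0"
    using False assms(1) by (intro log2_le) auto
  ultimately have "real N \<le> 408 * log 2 p" using N(2) unfolding budget_def by simp
  moreover have "real a \<le> real q / real p"
  proof -
    have "real (a * p) \<le> real q" using q by (simp only: of_nat_le_iff)
    then show ?thesis using assms(1) by (simp add: pos_le_divide_eq)
  qed
  moreover have "real (a - 1) \<le> real a" by simp
  ultimately have "real (N + (a - 1)) \<le> real q / real p + 408 * log 2 (real p)"
    unfolding of_nat_add by linarith
  with t show ?thesis by blast
qed

theorem theorem1:
  shows "\<exists>C\<^sub>1::real. C\<^sub>1 > 0 \<and>
    (\<forall>(p::nat) (q::nat) R. 0 < p \<longrightarrow> p < q \<longrightarrow> coprime p q \<longrightarrow> is_rectangle (real p) (real q) R \<longrightarrow>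
      (\<forall>T. square_tiling T R \<longrightarrow>
         real (card T) \<ge> max (real q / real p) (log 2 (real q))) \<and>
      (\<exists>T. square_tiling T R \<and> integer_sided T \<and>
         real (card T) \<le> real q / real p + C\<^sub>1 * log 2 (real p)))"
proof (intro exI[of _ "408::real"] conjI allI impI)
  fix p q :: nat and R
  assume pq: "0 < p" "p < q" "coprime p q" and R: "is_rectangle (real p) (real q) R"
  show "real (card T) \<ge> max (real q / real p) (log 2 (real q))" if "square_tiling T R" for T
    using card_square_tiling_ge[OF pq(1) _ pq(3) R that] pq(2) by simp
  obtain x y where xy: "R = {x..x + real p} \<times> {y..y + real q}"
    using R unfolding is_rectangle_def by blast
  obtain N where N: "tileable p q N" "real N \<le> real q / real p + 408 * log 2 (real p)"
    using tileable_rectangle[OF pq] by blast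
  then obtain T where T: "square_tiling T R" "integer_sided T" "card T \<le> N"
    unfolding tileable_def covers_def xy by blast
  then have "real (card T) \<le> real q / real p + 408 * log 2 (real p)"
    using N(2) by linarith
  with T show "\<exists>T. square_tiling T R \<and> integer_sided T \<and>
      real (card T) \<le> real q / real p + 408 * log 2 (real p)" by blast
qed simp

end
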